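(* Let $s \geq 1$ be an integer and let $\alpha_{s,2}$ be the type-$\alpha$ comb with $s$ teeth of length $2$. Then the number of linear extensions of $\alpha_{s,2}$ that avoid the pattern $312$ equals $C_{s+1}-C_s$, where $C_m = \frac{1}{m+1}\binom{2m}{m}$ is the $m$th Catalan number.
   Context: A linear extension of a finite poset $P$ on a set of integers is a listing $v=[v_1,\dots,v_n]$ of all elements of $P$, each exactly once, such that whenever $a \leq_P b$, $a$ appears before $b$. For $w \in S_3$, a sequence $v$ of distinct integers contains $w$ if there are indices $i<j<k$ with $(v_i,v_j,v_k)$ in the same relative order as $(w_1,w_2,w_3)$; otherwise $v$ avoids $w$. The type-$\alpha$ comb $\alpha_{s,t}$ is the poset on $\{1,\dots,st\}$ whose order is generated by the relations $i \leq i+1$ for $1 \leq i \leq s-1$ (the spine $1,\dots,s$) and $x \leq x+s$ for $1 \leq x \leq (t-1)s$. For $t=2$ this means: $1 \le 2 \le \dots \le s$ and $c \le c+s$ for $1 \le c \le s$. *)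

theory Defs
  imports Complex_Main
begin

text \<open>
  A finite poset is given by its carrier and its (reflexive) order relation, as in
  \<^const>\<open>partial_order_on\<close>. Listings are lists, indexed from \<open>0\<close>.
\<close>

definition linear_extensions :: "'a set \<Rightarrow> 'a rel \<Rightarrow> 'a list set" where
  "linear_extensions P r =
     {v. distinct v \<and> set v = P \<and>
         (\<forall>i < length v. \<forall>j < length v. (v ! i, v ! j) \<in> r \<longrightarrow> i \<le> j)}"

definition same_relative_order :: "'a::linorder list \<Rightarrow> 'b::linorder list \<Rightarrow> bool" where
  "same_relative_order xs ys \<longleftrightarrow>
     length xs = length ys \<and>
     (\<forall>a < length xs. \<forall>b < length xs. xs ! a < xs ! b \<longleftrightarrow> ys ! a < ys ! b)"

definition contains3 :: "'a::linorder list \<Rightarrow> nat list \<Rightarrow> bool" where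
  "contains3 v w \<longleftrightarrow>
     (\<exists>i j k. i < j \<and> j < k \<and> k < length v \<and> same_relative_order [v ! i, v ! j, v ! k] w)"

abbreviation avoids3 :: "'a::linorder list \<Rightarrow> nat list \<Rightarrow> bool" where
  "avoids3 v w \<equiv> \<not> contains3 v w"

definition comb_carrier :: "nat \<Rightarrow> nat \<Rightarrow> nat set" where
  "comb_carrier s t = {1..s * t}"

definition comb_alpha_gens :: "nat \<Rightarrow> nat \<Rightarrow> nat rel" where
  "comb_alpha_gens s t =
     {(i, i + 1) | i. 1 \<le> i \<and> i \<le> s - 1} \<union> {(x, x + s) | x. 1 \<le> x \<and> x \<le> (t - 1) * s}"

definition comb_alpha :: "nat \<Rightarrow> nat \<Rightarrow> nat rel" where
  "comb_alpha s t = (comb_alpha_gens s t)\<^sup>* \<inter> comb_carrier s t \<times> comb_carrier s t"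

lemma partial_order_on_comb_alpha: "partial_order_on (comb_carrier s t) (comb_alpha s t)"
proof -
  have le: "x \<le> y" if "(x, y) \<in> (comb_alpha_gens s t)\<^sup>*" for x y
    using that by (induction rule: rtrancl_induct) (auto simp: comb_alpha_gens_def)
  have "antisym (comb_alpha s t)"
    by (rule antisymI) (auto simp: comb_alpha_def intro!: le order.antisym)
  moreover have "trans (comb_alpha s t)"
    by (rule transI) (auto simp: comb_alpha_def intro: rtrancl_trans)
  moreover have "refl_on (comb_carrier s t) (comb_alpha s t)"
    by (auto simp: refl_on_def comb_alpha_def)
  ultimately show ?thesis
    by (auto simp: partial_order_on_def preorder_on_def comb_alpha_def)
qed

definition catalan :: "nat \<Rightarrow> real" where
  "catalan m = 1 / (real m + 1) * real ((2 * m) choose m)"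

end

theory Submission
  imports Defs
begin

text \<open>
  Once a tooth has been listed, at most one spine element can follow, for two of them would form a
  \<open>312\<close> with that tooth. So the admissible extensions are the words \<open>[1, \<dots>, s - 1] @ w\<close>, where \<open>w\<close>
  is a \<open>312\<close>-avoiding listing of \<open>{s..2 * s}\<close> with \<open>s\<close> before \<open>2 * s\<close>. In a \<open>312\<close>-avoiding
  listing all entries before the minimum are smaller than all entries after it; this yields the
  Catalan recurrence, and it shows that \<open>s\<close> comes after \<open>2 * s\<close> only if \<open>s\<close> is last. Deleting the
  final \<open>s\<close> from those listings leaves a \<open>312\<close>-avoiding listing of \<open>{s + 1..2 * s}\<close>.
\<close>

section \<open>Catalan numbers\<close>

lemma catalan_0 [simp]: "catalan 0 = 1"
  by (simp add: catalan_def)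

text \<open>The two middle entries of row \<open>2 * n + 1\<close> of Pascal's triangle coincide,
  and absorption (\<open>Suc_times_binomial\<close>) reduces them to the central entry of row
  \<open>2 * n\<close>. Denominators stay cleared so that the factor \<open>n + 2\<close> can be
  matched against weights in sums.\<close>

lemma catalan_Suc: "(real n + 2) * catalan (Suc n) = (4 * real n + 2) * catalan n"
proof -
  have "Suc (2 * n) choose Suc n = Suc (2 * n) choose n"
    using binomial_symmetric[of "Suc n" "Suc (2 * n)"] by simp
  then have "(2 * Suc n) choose Suc n = 2 * (Suc (2 * n) choose Suc n)"
    by (simp add: mult_2)
  with Suc_times_binomial[of n "2 * n"]
  have "Suc n * ((2 * Suc n) choose Suc n) = (4 * n + 2) * ((2 * n) choose n)"
    by (simp only: mult.left_commute[of "Suc n" 2]) simp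
  then have "(real n + 1) * real ((2 * Suc n) choose Suc n) = (4 * real n + 2) * real ((2 * n) choose n)"
    by (subst (asm) of_nat_eq_iff[where 'a = real, symmetric])
       (simp only: of_nat_mult of_nat_add of_nat_Suc of_nat_numeral add.commute[of 1])
  moreover have "(real n + 2) * (1 / (real n + 2) * a) = (4 * real n + 2) * (1 / (real n + 1) * b)"
    if "(real n + 1) * a = (4 * real n + 2) * b" for a b
  proof -
    have "a = (4 * real n + 2) * b / (real n + 1)"
      using that by (simp add: nonzero_eq_divide_eq mult.commute)
    then show ?thesis by simp
  qed
  moreover have "real (Suc n) + 1 = real n + 2" by simp
  ultimately show ?thesis
    unfolding catalan_def by presburger
qed

text \<open>
  Reflecting \<open>k\<close> to \<open>n - k\<close> shows that the factor \<open>k\<close> averages to \<open>n / 2\<close>; this turns the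
  first-order recurrence of the Catalan numbers into one for their convolution.
\<close>

lemma catalan_weighted_convolution:
  "2 * (\<Sum>k\<le>n. real k * (catalan k * catalan (n - k))) =
   real n * (\<Sum>k\<le>n. catalan k * catalan (n - k))"
proof -
  have "(\<Sum>k\<le>n. real k * (catalan k * catalan (n - k))) =
        (\<Sum>k\<le>n. real (n - k) * (catalan (n - k) * catalan (n - (n - k))))"
    using sum.nat_diff_reindex[of "\<lambda>k. real k * (catalan k * catalan (n - k))" "Suc n"]
    by (simp add: lessThan_Suc_atMost)
  also have "\<dots> = (\<Sum>k\<le>n. (real n - real k) * (catalan k * catalan (n - k)))"
    by (rule sum.cong) auto
  finally show ?thesis
    by (simp add: left_diff_distrib sum_subtractf sum_distrib_left)
qed

lemma catalan_convolution: "(\<Sum>k\<le>n. catalan k * catalan (n - k)) = catalan (Suc n)"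
proof (induction n)
  case 0
  show ?case using catalan_Suc[of 0] by simp
next
  case (Suc n)
  let ?S = "\<lambda>n. \<Sum>k\<le>n. catalan k * catalan (n - k)"
  let ?W = "\<lambda>n. \<Sum>k\<le>n. real k * (catalan k * catalan (n - k))"
  \<comment> \<open>Adding \<open>?S\<close> to \<open>?W\<close> gives the weight
    \<open>k + 1\<close>; the index shift turns it into \<open>k + 2\<close>, the factor that
    \<open>catalan_Suc\<close> rewrites.\<close>
  have "?W (Suc n) + ?S (Suc n) =
      (\<Sum>k\<le>Suc n. (real k + 1) * catalan k * catalan (Suc n - k))"
    by (simp only: sum.distrib[symmetric]) (simp add: algebra_simps)
  also have "\<dots> = catalan (Suc n) +
      (\<Sum>k\<le>n. (real k + 2) * catalan (Suc k) * catalan (n - k))"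
    by (subst sum.atMost_Suc_shift) (simp add: add.commute)
  also have "(\<Sum>k\<le>n. (real k + 2) * catalan (Suc k) * catalan (n - k)) =
      4 * ?W n + 2 * ?S n"
    by (simp only: catalan_Suc) (simp add: sum_distrib_left sum.distrib[symmetric] algebra_simps)
  finally have "?W (Suc n) + ?S (Suc n) = catalan (Suc n) + (4 * ?W n + 2 * ?S n)" .
  \<comment> \<open>The reflection identity eliminates \<open>?W\<close> at both \<open>n\<close>
    and \<open>Suc n\<close>. By the induction hypothesis the right-hand side is then
    \<open>4 * n + 6\<close> times \<open>catalan (Suc n)\<close>, which is the recurrence at
    \<open>Suc n\<close>.\<close>
  with catalan_weighted_convolution[of n] catalan_weighted_convolution[of "Suc n"]
  have "(real n + 3) * ?S (Suc n) = 2 * catalan (Suc n) + 4 * real n * ?S n + 4 * ?S n"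
    by (simp add: algebra_simps del: sum.atMost_Suc)
  also have "\<dots> = (real n + 3) * catalan (Suc (Suc n))"
    using catalan_Suc[of "Suc n"] by (simp add: Suc algebra_simps)
  finally show ?case by simp
qed

section \<open>Listings avoiding 312\<close>

text \<open>A recursive form of avoidance, suited to list induction: the head is tested in the role
  of 3, so no ascending pair below it may follow.\<close>

primrec avoids_312 :: "'a::linorder list \<Rightarrow> bool" where
  "avoids_312 [] = True"
| "avoids_312 (x # v) \<longleftrightarrow> sorted_wrt (\<lambda>b c. \<not> (b < c \<and> c < x)) v \<and> avoids_312 v"

lemma same_relative_order_312: "same_relative_order [a, b, c] [3, 1, 2 :: nat] \<longleftrightarrow> b < c \<and> c < a"
  for a b c :: "'a::linorder"
  by (auto simp: same_relative_order_def All_less_Suc numeral_3_eq_3 nth_Cons')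

text \<open>An occurrence that uses the head must use it as its first entry, the 3; every other
  occurrence lies in the tail.\<close>

lemma contains3_Cons:
  "contains3 (x # v) [3, 1, 2] \<longleftrightarrow>
   \<not> sorted_wrt (\<lambda>b c. \<not> (b < c \<and> c < x)) v \<or> contains3 v [3, 1, 2]"
proof
  assume "contains3 (x # v) [3, 1, 2]"
  then obtain i j k where ijk: "i < j" "j < k" "k < length (x # v)"
      "(x # v) ! j < (x # v) ! k" "(x # v) ! k < (x # v) ! i"
    unfolding contains3_def same_relative_order_312 by blast
  then obtain j' k' where [simp]: "j = Suc j'" "k = Suc k'"
    by (metis less_imp_Suc_add)
  show "\<not> sorted_wrt (\<lambda>b c. \<not> (b < c \<and> c < x)) v \<or> contains3 v [3, 1, 2]"
  proof (cases i)
    case 0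
    with ijk show ?thesis by (auto simp: sorted_wrt_iff_nth_less)
  next
    case (Suc i')
    with ijk have "i' < j' \<and> j' < k' \<and> k' < length v \<and> v ! j' < v ! k' \<and> v ! k' < v ! i'" by auto
    then show ?thesis unfolding contains3_def same_relative_order_312 by blast
  qed
next
  assume "\<not> sorted_wrt (\<lambda>b c. \<not> (b < c \<and> c < x)) v \<or> contains3 v [3, 1, 2]"
  then show "contains3 (x # v) [3, 1, 2]"
  proof
    assume "\<not> sorted_wrt (\<lambda>b c. \<not> (b < c \<and> c < x)) v"
    then obtain j k where "j < k" "k < length v" "v ! j < v ! k" "v ! k < x"
      by (auto simp: sorted_wrt_iff_nth_less)
    then show ?thesis
      unfolding contains3_def same_relative_order_312
      by (intro exI[of _ 0] exI[of _ "Suc j"] exI[of _ "Suc k"]) auto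
  next
    assume "contains3 v [3, 1, 2]"
    then obtain i j k where "i < j" "j < k" "k < length v" "v ! j < v ! k" "v ! k < v ! i"
      unfolding contains3_def same_relative_order_312 by blast
    then show ?thesis
      unfolding contains3_def same_relative_order_312
      by (intro exI[of _ "Suc i"] exI[of _ "Suc j"] exI[of _ "Suc k"]) auto
  qed
qed

lemma avoids3_iff_avoids_312: "avoids3 v [3, 1, 2] \<longleftrightarrow> avoids_312 v"
  by (induction v) (simp_all add: contains3_Cons contains3_def[of "[]"] del: One_nat_def)

lemma sorted_wrt_no_12_below:
  "\<forall>y \<in> set v. x \<le> y \<Longrightarrow> sorted_wrt (\<lambda>b c. \<not> (b < c \<and> c < x)) v" for x :: "'a::linorder"
  by (induction v) (auto simp: not_less)

text \<open>An \<open>x\<close> before \<open>m\<close> and a smaller \<open>y\<close> after it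
  would form the pattern \<open>x\<close>, \<open>m\<close>, \<open>y\<close>. Conversely, if
  \<open>u\<close> lies below \<open>w\<close>, a 3 taken from \<open>u\<close> exceeds only
  \<open>m\<close> and entries of \<open>u\<close>; the minimum \<open>m\<close> cannot be the 2,
  and as the 1 it would need a 2 from \<open>w\<close>.\<close>

lemma avoids_312_append_Min:
  assumes "\<forall>x \<in> set u \<union> set w. m < x" and "distinct (u @ w)"
  shows "avoids_312 (u @ m # w) \<longleftrightarrow>
         avoids_312 u \<and> avoids_312 w \<and> (\<forall>x \<in> set u. \<forall>y \<in> set w. x < y)"
  using assms
proof (induction u)
  case Nil
  then show ?case using sorted_wrt_no_12_below[of w m] by (auto simp: less_imp_le)
next
  case (Cons x u)
  have "sorted_wrt (\<lambda>b c. \<not> (b < c \<and> c < x)) (u @ m # w) \<longleftrightarrow>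
        sorted_wrt (\<lambda>b c. \<not> (b < c \<and> c < x)) u \<and> (\<forall>y \<in> set w. x < y)"
    (is "?L \<longleftrightarrow> ?R")
  proof
    assume ?L
    then have "\<forall>y \<in> set w. x \<le> y"
    proof (intro ballI)
      fix y assume "y \<in> set w"
      with \<open>?L\<close> have "\<not> (m < y \<and> y < x)" by (simp add: sorted_wrt_append)
      with Cons.prems \<open>y \<in> set w\<close> show "x \<le> y" by (auto simp: not_less)
    qed
    moreover have "x \<notin> set w" using Cons.prems by simp
    ultimately show ?R
      using \<open>?L\<close> by (auto simp: sorted_wrt_append order_le_less)
  next
    assume R: ?R
    then have "sorted_wrt (\<lambda>b c. \<not> (b < c \<and> c < x)) w"
      by (intro sorted_wrt_no_12_below) (auto simp: less_imp_le)
    with R show ?L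
      using Cons.prems by (auto simp: sorted_wrt_append dest: order.asym)
  qed
  with Cons show ?case by auto
qed

text \<open>No entry of \<open>u\<close> exceeds anything after it, so none can be the 3. This
  strips the spine prefix from a listing.\<close>

lemma avoids_312_append_sorted:
  assumes "sorted u" and "\<forall>x \<in> set u. \<forall>y \<in> set w. x \<le> y"
  shows "avoids_312 (u @ w) \<longleftrightarrow> avoids_312 w"
  using assms
proof (induction u)
  case (Cons x u)
  then have "\<forall>y \<in> set (u @ w). x \<le> y" by auto
  then have "sorted_wrt (\<lambda>b c. \<not> (b < c \<and> c < x)) (u @ w)"
    by (rule sorted_wrt_no_12_below)
  with Cons show ?case by auto
qed auto

lemma avoids_312_upt_append:
  "\<forall>y \<in> set w. n \<le> y \<Longrightarrow> avoids_312 ([m..<n] @ w) \<longleftrightarrow> avoids_312 w"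
  by (rule avoids_312_append_sorted) auto

section \<open>Counting the 312-avoiding listings of an interval\<close>

definition avoiders_312 :: "'a::linorder set \<Rightarrow> 'a list set" where
  "avoiders_312 S = {v. distinct v \<and> set v = S \<and> avoids_312 v}"

lemma finite_avoiders_312: "finite S \<Longrightarrow> finite (avoiders_312 S)"
  by (rule finite_subset[OF _ finite_subset_distinct[of S]]) (auto simp: avoiders_312_def)

text \<open>Since \<open>u\<close> must lie below \<open>w\<close>, the two parts split
  \<open>{Suc a..<c}\<close> into consecutive intervals, with \<open>p\<close> as the cut.\<close>

lemma append_Min_in_avoiders_312_iff:
  assumes "a < c"
  shows "u @ a # w \<in> avoiders_312 {a..<c} \<longleftrightarrow>
         (\<exists>p \<in> {Suc a..c}. u \<in> avoiders_312 {Suc a..<p} \<and> w \<in> avoiders_312 {p..<c})"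
    (is "?L \<longleftrightarrow> ?R")
proof
  assume L: ?L
  then have d: "distinct (u @ w)" "a \<notin> set u \<union> set w" and "set (u @ a # w) = {a..<c}"
    by (auto simp: avoiders_312_def)
  then have "set u \<union> set w = {a..<c} - {a}" by auto
  also have "\<dots> = {Suc a..<c}" by auto
  finally have s: "set u \<union> set w = {Suc a..<c}" .
  then have gt: "\<forall>x \<in> set u \<union> set w. a < x" by auto
  from L have av: "avoids_312 u" "avoids_312 w" "\<forall>x \<in> set u. \<forall>y \<in> set w. x < y"
    using avoids_312_append_Min[OF gt d(1)] by (auto simp: avoiders_312_def)
  \<comment> \<open>If nothing follows the minimum, the cut is the right end \<open>c\<close>, which
    makes \<open>{p..<c}\<close> empty.\<close>
  define p where "p = (if set w = {} then c else Min (set w))"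
  have p: "p \<in> {Suc a..c}"
  proof (cases "set w = {}")
    case False
    then have "p \<in> set u \<union> set w" unfolding p_def by simp
    then show ?thesis unfolding s by auto
  qed (use assms in \<open>auto simp: p_def\<close>)
  have ux: "x < p" if "x \<in> set u" for x
    using that av(3) s unfolding p_def by auto
  have wx: "p \<le> x" if "x \<in> set w" for x
    using that unfolding p_def by auto
  have "set u = {Suc a..<p}" "set w = {p..<c}"
  proof -
    have "x \<in> set u \<longleftrightarrow> x \<in> set u \<union> set w \<and> x < p"
      "x \<in> set w \<longleftrightarrow> x \<in> set u \<union> set w \<and> p \<le> x" for x
      using ux[of x] wx[of x] by auto
    then show "set u = {Suc a..<p}" "set w = {p..<c}"
      unfolding s set_eq_iff using p by simp_all linarith+
  qed
  with p av d show ?R by (auto simp: avoiders_312_def)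
next
  assume ?R
  then obtain p where p: "p \<in> {Suc a..c}" and u: "u \<in> avoiders_312 {Suc a..<p}"
    and w: "w \<in> avoiders_312 {p..<c}" by blast
  have "\<forall>x \<in> set u \<union> set w. a < x" "distinct (u @ w)" "\<forall>x \<in> set u. \<forall>y \<in> set w. x < y"
    using p u w by (auto simp: avoiders_312_def)
  with avoids_312_append_Min[of u w a] p u w assms show ?L
    by (auto simp: avoiders_312_def)
qed

lemma avoiders_312_decomp:
  assumes "a < c"
  shows "avoiders_312 {a..<c} =
    (\<Union>p \<in> {Suc a..c}. (\<lambda>(u, w). u @ a # w) ` (avoiders_312 {Suc a..<p} \<times> avoiders_312 {p..<c}))"
    (is "_ = ?R")
proof (intro set_eqI iffI)
  fix v assume v: "v \<in> avoiders_312 {a..<c}"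
  with assms have "a \<in> set v" by (auto simp: avoiders_312_def)
  then obtain u w where uw: "v = u @ a # w" by (meson split_list)
  with v append_Min_in_avoiders_312_iff[OF assms]
  obtain p where "p \<in> {Suc a..c}" "(u, w) \<in> avoiders_312 {Suc a..<p} \<times> avoiders_312 {p..<c}"
    by blast
  then show "v \<in> ?R"
    unfolding uw by (intro UN_I[of p] image_eqI[of _ _ "(u, w)"]) simp_all
next
  fix v assume "v \<in> ?R"
  then obtain p u w where "p \<in> {Suc a..c}" "u \<in> avoiders_312 {Suc a..<p}"
    "w \<in> avoiders_312 {p..<c}" "v = u @ a # w" by auto
  then show "v \<in> avoiders_312 {a..<c}"
    using append_Min_in_avoiders_312_iff[OF assms] by blast
qed

lemma append_Cons_eq_if_notin:
  assumes "u @ a # w = u' @ a # w'" and "a \<notin> set u" and "a \<notin> set u'"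
  shows "u = u' \<and> w = w'"
  using assms
proof (induction u arbitrary: u')
  case Nil
  then show ?case by (cases u') auto
next
  case (Cons x u)
  then show ?case by (cases u') auto
qed

text \<open>The position of \<open>a\<close> determines \<open>u\<close> and \<open>w\<close>, and
  the entries of \<open>u\<close> determine \<open>p\<close>; hence the pieces are disjoint and each
  is a product.\<close>

lemma card_avoiders_312_decomp:
  assumes "a < c"
  shows "card (avoiders_312 {a..<c}) =
    (\<Sum>p \<in> {Suc a..c}. card (avoiders_312 {Suc a..<p}) * card (avoiders_312 {p..<c}))"
proof -
  let ?f = "\<lambda>(u, w). u @ a # w"
  have notin: "a \<notin> set u" if "u \<in> avoiders_312 {Suc a..<p}" for u p
    using that by (simp add: avoiders_312_def)
  have inj: "inj_on ?f (avoiders_312 {Suc a..<p} \<times> B)" for p and B :: "nat list set"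
  proof (rule inj_onI, clarify)
    fix u w u' w'
    assume "u @ a # w = u' @ a # w'" "u \<in> avoiders_312 {Suc a..<p}" "u' \<in> avoiders_312 {Suc a..<p}"
    then show "u = u' \<and> w = w'" by (meson append_Cons_eq_if_notin notin)
  qed
  have "card (avoiders_312 {a..<c}) =
    (\<Sum>p \<in> {Suc a..c}. card (?f ` (avoiders_312 {Suc a..<p} \<times> avoiders_312 {p..<c})))"
    unfolding avoiders_312_decomp[OF assms]
  proof (rule card_UN_disjoint, simp, intro ballI)
    show "finite (?f ` (avoiders_312 {Suc a..<p} \<times> avoiders_312 {p..<c}))" for p
      by (simp add: finite_avoiders_312)
  next
    show "\<forall>p \<in> {Suc a..c}. \<forall>q \<in> {Suc a..c}. p \<noteq> q \<longrightarrow>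
      ?f ` (avoiders_312 {Suc a..<p} \<times> avoiders_312 {p..<c}) \<inter>
      ?f ` (avoiders_312 {Suc a..<q} \<times> avoiders_312 {q..<c}) = {}"
    proof (intro ballI impI equals0I)
      fix p q v
      assume pq: "p \<in> {Suc a..c}" "q \<in> {Suc a..c}" "p \<noteq> q"
        and v: "v \<in> ?f ` (avoiders_312 {Suc a..<p} \<times> avoiders_312 {p..<c}) \<inter>
          ?f ` (avoiders_312 {Suc a..<q} \<times> avoiders_312 {q..<c})"
      from v obtain u w where u: "v = u @ a # w" "u \<in> avoiders_312 {Suc a..<p}" by auto
      from v obtain u' w' where u': "v = u' @ a # w'" "u' \<in> avoiders_312 {Suc a..<q}" by auto
      from u u' have "u = u'" by (metis append_Cons_eq_if_notin notin)
      with u u' have "{Suc a..<p} = {Suc a..<q}" by (simp add: avoiders_312_def)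
      then have "card {Suc a..<p} = card {Suc a..<q}" by simp
      with pq show False by auto
    qed
  qed
  then show ?thesis
    by (simp add: card_image[OF inj] card_cartesian_product)
qed

lemma card_avoiders_312: "real (card (avoiders_312 {a..<a + n})) = catalan n"
\<comment> \<open>The left end varies because both factors are counts over shorter intervals that
  start elsewhere. With \<open>k\<close> entries before the minimum, their lengths are
  \<open>k\<close> and \<open>m - k\<close>.\<close>
proof (induction n arbitrary: a rule: less_induct)
  case (less n)
  show ?case
  proof (cases n)
    case 0
    have "avoiders_312 {} = {[] :: nat list}"
      by (auto simp: avoiders_312_def)
    with 0 show ?thesis by simp
  next
    case (Suc m)
    have "real (card (avoiders_312 {a..<a + n})) =
      (\<Sum>p \<in> {Suc a..Suc a + m}.
        real (card (avoiders_312 {Suc a..<p})) * real (card (avoiders_312 {p..<a + n})))"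
      using Suc by (subst card_avoiders_312_decomp) auto
    also have "\<dots> = (\<Sum>k\<le>m. real (card (avoiders_312 {Suc a..<Suc a + k})) *
        real (card (avoiders_312 {Suc a + k..<Suc a + k + (m - k)})))"
      using Suc by (intro sum.reindex_bij_witness[of _ "\<lambda>k. Suc a + k" "\<lambda>p. p - Suc a"])
        (auto simp: add.commute)
    also have "\<dots> = (\<Sum>k\<le>m. catalan k * catalan (m - k))"
      by (intro sum.cong refl arg_cong2[of _ _ _ _ "(*)"] less) (use Suc in auto)
    finally show ?thesis by (simp add: catalan_convolution Suc)
  qed
qed

section \<open>Linear extensions of the comb\<close>

text \<open>The index condition is contraposed into a \<open>sorted_wrt\<close> condition, which
  splits over \<open>@\<close>.\<close>

lemma linear_extensions_iff:
  "v \<in> linear_extensions P r \<longleftrightarrow>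
   distinct v \<and> set v = P \<and> sorted_wrt (\<lambda>x y. (y, x) \<notin> r) v"
proof -
  have "(\<forall>i < n. \<forall>j < n. Q i j \<longrightarrow> i \<le> j) \<longleftrightarrow> (\<forall>i j. i < j \<longrightarrow> j < n \<longrightarrow> \<not> Q j i)"
    for Q and n :: nat
    by (meson leD not_le order.strict_trans)
  then show ?thesis
    by (simp add: linear_extensions_def sorted_wrt_iff_nth_less)
qed

text \<open>A chain of generators climbs the spine and takes at most one step onto a tooth, from
  which no generator leads on.\<close>

lemma comb_alpha_cases:
  assumes "(x, y) \<in> comb_alpha s 2"
  shows "x = y \<or> x < y \<and> y \<le> s \<or> x \<le> s \<and> x + s \<le> y"
proof -
  have "(x, y) \<in> (comb_alpha_gens s 2)\<^sup>*" using assms by (simp add: comb_alpha_def)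
  then show ?thesis
    by (induction rule: rtrancl_induct) (auto simp: comb_alpha_gens_def)
qed

lemma comb_alpha_spine:
  assumes "1 \<le> x" "x \<le> y" "y \<le> s"
  shows "(x, y) \<in> comb_alpha s 2"
proof -
  have "(x, y) \<in> (comb_alpha_gens s 2)\<^sup>*"
    using assms(2,3)
  proof (induction y rule: dec_induct)
    case (step n)
    with assms(1) have "(n, Suc n) \<in> comb_alpha_gens s 2" by (auto simp: comb_alpha_gens_def)
    with step show ?case by (meson Suc_leD rtrancl.rtrancl_into_rtrancl)
  qed simp
  with assms show ?thesis by (auto simp: comb_alpha_def comb_carrier_def)
qed

lemma comb_alpha_last_tooth:
  assumes "1 \<le> s"
  shows "(s, 2 * s) \<in> comb_alpha s 2"
proof -
  have "(s, 2 * s) \<in> comb_alpha_gens s 2" using assms by (auto simp: comb_alpha_gens_def)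
  with assms show ?thesis by (auto simp: comb_alpha_def comb_carrier_def)
qed

text \<open>By induction, the next entry is forced: a larger spine element would precede
  \<open>Suc k\<close>, and a tooth would form a 312 with the later \<open>s - 1\<close> and
  \<open>s\<close>.\<close>

lemma spine_prefix:
  assumes v: "v \<in> linear_extensions (comb_carrier s 2) (comb_alpha s 2)" and "avoids_312 v"
    and "k < s"
  shows "\<exists>w. v = [1..<Suc k] @ w"
  using \<open>k < s\<close>
proof (induction k)
  case (Suc k)
  then obtain w where w: "v = [1..<Suc k] @ w" by auto
  from v have "distinct v" "set v = {1..2 * s}" and sw: "sorted_wrt (\<lambda>x y. (y, x) \<notin> comb_alpha s 2) w"
    by (auto simp: linear_extensions_iff comb_carrier_def w sorted_wrt_append mult.commute)
  then have "set w = set v - set [1..<Suc k]"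
    unfolding w by (subst set_append) auto
  also have "\<dots> = {Suc k..2 * s}"
    unfolding \<open>set v = _\<close> by auto
  finally have set_w: "set w = {Suc k..2 * s}" .
  have av: "avoids_312 w"
    using \<open>avoids_312 v\<close> avoids_312_upt_append[of w "Suc k" 1] by (simp add: w set_w del: upt_Suc)
  obtain x w' where xw: "w = x # w'"
    using set_w Suc.prems by (cases w) auto
  have mem: "y = x \<or> y \<in> set w' \<longleftrightarrow> Suc k \<le> y \<and> y \<le> 2 * s" for y
    using set_w by (metis atLeastAtMost_iff set_ConsD xw list.set_intros)
  have "x = Suc k"
  proof (rule ccontr)
    assume "x \<noteq> Suc k"
    with mem[of x] mem[of "Suc k"] Suc.prems have "x > Suc k" "Suc k \<in> set w'" by auto
    with sw xw have "(Suc k, x) \<notin> comb_alpha s 2" by auto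
    with comb_alpha_spine[of "Suc k" x s] \<open>x > Suc k\<close> have "s < x" by linarith
    \<comment> \<open>Here \<open>Suc k < s\<close>, so \<open>s - 1\<close> and \<open>s\<close>
      are both still unlisted. The spine order puts \<open>s - 1\<close> first, and
      \<open>x\<close>, \<open>s - 1\<close>, \<open>s\<close> is the forbidden pattern.\<close>
    with mem[of "s - 1"] mem[of s] Suc.prems have "s - 1 \<in> set w'" "s \<in> set w'" by auto
    then obtain p q where pq: "w' = p @ (s - 1) # q" by (meson split_list)
    from comb_alpha_spine[of "s - 1" s s] Suc.prems have "(s - 1, s) \<in> comb_alpha s 2" by auto
    with sw xw pq have "s \<notin> set p" by (auto simp: sorted_wrt_append)
    with pq \<open>s \<in> set w'\<close> Suc.prems have "s \<in> set q" by auto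
    with av xw pq \<open>s < x\<close> Suc.prems show False by (auto simp: sorted_wrt_append)
  qed
  with w xw show ?case by simp
qed auto

text \<open>Beyond the forced prefix, the only relation left to respect is that \<open>s\<close>
  precedes \<open>2 * s\<close>, and \<open>?B\<close> collects the avoiders violating it. The
  intervals are written so that their lengths \<open>Suc s\<close> and \<open>s\<close> can be read
  off for \<open>card_avoiders_312\<close>.\<close>

lemma comb_avoiders_eq:
  assumes "1 \<le> s"
  shows "{v \<in> linear_extensions (comb_carrier s 2) (comb_alpha s 2). avoids_312 v} =
    (@) [1..<s] ` (avoiders_312 {s..<s + Suc s} -
      (\<lambda>u. u @ [s]) ` avoiders_312 {Suc s..<Suc s + s})" (is "?L = ?f ` (?A - ?B)")
proof (intro set_eqI iffI)
  fix v assume "v \<in> ?L"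
  then have v: "v \<in> linear_extensions (comb_carrier s 2) (comb_alpha s 2)" and av: "avoids_312 v"
    by auto
  \<comment> \<open>Taking \<open>k = s - 1\<close> leaves \<open>s\<close> itself in
    \<open>w\<close>: one spine element may still follow teeth.\<close>
  obtain w where w: "v = [1..<s] @ w"
    using spine_prefix[OF v av, of "s - 1"] assms by auto
  from v have d: "distinct v" "set v = {1..2 * s}" and sw: "sorted_wrt (\<lambda>x y. (y, x) \<notin> comb_alpha s 2) w"
    by (auto simp: linear_extensions_iff comb_carrier_def w sorted_wrt_append mult.commute)
  then have "set w = set v - set [1..<s]"
    unfolding w by (subst set_append) auto
  then have set_w: "set w = {s..<s + Suc s}"
    using d assms by auto
  have "avoids_312 w"
    using av avoids_312_upt_append[of w s 1] by (simp add: w set_w)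
  with d w set_w have "w \<in> ?A" by (auto simp: avoiders_312_def)
  moreover have "w \<notin> ?B"
  proof
    assume "w \<in> ?B"
    then obtain u where u: "w = u @ [s]" "set u = {Suc s..<Suc s + s}"
      by (auto simp: avoiders_312_def)
    then have "2 * s \<in> set u" using assms by auto
    with sw u(1) comb_alpha_last_tooth[OF assms] show False by (auto simp: sorted_wrt_append)
  qed
  ultimately show "v \<in> ?f ` (?A - ?B)" using w by blast
next
  fix v assume "v \<in> ?f ` (?A - ?B)"
  then obtain w where v: "v = [1..<s] @ w" and w: "w \<in> ?A" "w \<notin> ?B" by blast
  have set_w: "set w = {s..2 * s}" and "distinct w" "avoids_312 w"
    using w by (auto simp: avoiders_312_def)
  then obtain u t where ut: "w = u @ s # t"
    by (metis assms atLeastAtMost_iff le_add2 mult_2 order_refl split_list)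
  with w(1) append_Min_in_avoiders_312_iff[of s "s + Suc s" u t]
  obtain p where p: "p \<in> {Suc s..s + Suc s}"
    and u: "u \<in> avoiders_312 {Suc s..<p}" and t: "t \<in> avoiders_312 {p..<s + Suc s}" by auto
  \<comment> \<open>Otherwise \<open>t\<close> would be empty and \<open>w\<close> would lie in
    \<open>?B\<close>. So \<open>p\<close> is at most \<open>2 * s\<close>, and \<open>2 * s\<close>
    cannot occur in \<open>u\<close>, before \<open>s\<close>.\<close>
  have "p \<noteq> s + Suc s"
    using w(2) ut u t by (auto simp: avoiders_312_def)
  with p u have u_less: "x < 2 * s" if "x \<in> set u" for x
    using that by (auto simp: avoiders_312_def)
  \<comment> \<open>All entries of \<open>w\<close> are at least \<open>s\<close>, so the order
    restricted to them has a single nontrivial pair.\<close>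
  have only: "x = y \<or> x = s \<and> y = 2 * s" if "(x, y) \<in> comb_alpha s 2" "x \<in> set w" "y \<in> set w" for x y
    using comb_alpha_cases[OF that(1)] that(2,3) set_w by auto
  have "sorted_wrt (\<lambda>x y. (y, x) \<notin> comb_alpha s 2) w"
  proof (clarsimp simp: sorted_wrt_iff_nth_less)
    fix i j assume ij: "i < j" "j < length w" "(w ! j, w ! i) \<in> comb_alpha s 2"
    then have "w ! j \<noteq> w ! i" using \<open>distinct w\<close> by (simp add: nth_eq_iff_index_eq)
    with only[OF ij(3)] ij have *: "w ! j = s" "w ! i = 2 * s" by auto
    have "w ! length u = s" "length u < length w" using ut by auto
    with * ij \<open>distinct w\<close> have "j = length u" by (metis nth_eq_iff_index_eq)
    with ij ut have "w ! i \<in> set u" by (simp add: nth_append)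
    with u_less * show False by force
  qed
  moreover have greater: "(y, x) \<notin> comb_alpha s 2" if "x < y" for x y
    using comb_alpha_cases[of y x s] that by auto
  then have "sorted_wrt (\<lambda>x y. (y, x) \<notin> comb_alpha s 2) [1..<s]"
    by (intro sorted_wrt_mono_rel[OF _ sorted_wrt_upt[of 1 s]])
  moreover have "\<forall>x \<in> set [1..<s]. \<forall>y \<in> set w. (y, x) \<notin> comb_alpha s 2"
    using set_w greater by auto
  ultimately have "sorted_wrt (\<lambda>x y. (y, x) \<notin> comb_alpha s 2) v"
    by (auto simp: v sorted_wrt_append)
  moreover have "set v = {1..s * 2}" "distinct v"
    using set_w \<open>distinct w\<close> assms by (auto simp: v)
  moreover have "avoids_312 v"
    using \<open>avoids_312 w\<close> avoids_312_upt_append[of w s 1] by (simp add: v set_w)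
  ultimately show "v \<in> ?L"
    by (simp add: linear_extensions_iff comb_carrier_def)
qed

theorem theorem6:
  fixes s :: nat
  assumes "s \<ge> 1"
  shows "real (card {v \<in> linear_extensions (comb_carrier s 2) (comb_alpha s 2).
                       avoids3 v [3, 1, 2]})
         = catalan (s + 1) - catalan s"
proof -
  let ?A = "avoiders_312 {s..<s + Suc s}" and ?C = "avoiders_312 {Suc s..<Suc s + s}"
  have sub: "(\<lambda>u. u @ [s]) ` ?C \<subseteq> ?A"
  proof safe
    fix u assume "u \<in> ?C"
    \<comment> \<open>Listings ending in \<open>s\<close> are those with an empty second block,
      where the cut is the right end \<open>s + Suc s\<close>.\<close>
    moreover have "[] \<in> avoiders_312 {s + Suc s..<s + Suc s}" by (simp add: avoiders_312_def)
    ultimately show "u @ [s] \<in> ?A"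
      by (subst append_Min_in_avoiders_312_iff) (auto intro!: bexI[of _ "s + Suc s"] simp: add.commute)
  qed
  have "card ((@) [1..<s] ` (?A - (\<lambda>u. u @ [s]) ` ?C)) = card (?A - (\<lambda>u. u @ [s]) ` ?C)"
    by (intro card_image inj_onI) simp
  also have "\<dots> = card ?A - card ((\<lambda>u. u @ [s]) ` ?C)"
    by (intro card_Diff_subset sub finite_imageI finite_avoiders_312) simp
  also have "card ((\<lambda>u. u @ [s]) ` ?C) = card ?C"
    by (intro card_image inj_onI) simp
  \<comment> \<open>The inclusion \<open>sub\<close> bounds the subtracted cardinality, so the
    truncated difference of naturals agrees with the real one.\<close>
  finally have "real (card ((@) [1..<s] ` (?A - (\<lambda>u. u @ [s]) ` ?C))) = real (card ?A) - real (card ?C)"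
    using card_mono[OF finite_avoiders_312 sub] \<open>card ((\<lambda>u. u @ [s]) ` ?C) = card ?C\<close>
    by (simp add: of_nat_diff)
  then show ?thesis
    unfolding avoids3_iff_avoids_312 comb_avoiders_eq[OF assms] card_avoiders_312 by simp
qed

end
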